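(* Let $\{p_{n,k}\}_{n\ge 1,\,k\ge 1}$ be the array of real numbers defined by $p_{1,1}=1$, $p_{n,k}=0$ for all $k>n$, and $$p_{n,k}=\frac{k-1}{2n-1}\,p_{n-1,k-1}+\frac{2n-1-k}{2n-1}\,p_{n-1,k}\qquad\text{for all } n\ge 2 \text{ and } 1\le k\le n,$$ where for $k=1$ the first term on the right-hand side is $0$. Then for all $n>1$ and $k=1,\dots,n-1$, $$p_{n,k}=\frac{n!\,(n-1)!}{(2n)!}\,2^{2n-k}\left[1+(k-1)\sum_{j=0}^{n-k-1}\frac{2^{-2(j+1)}}{(j+1)!}\,\frac{(k+2j)!}{(k+j)!}\right].$$
   Context: The indices $n,k$ are positive integers. The numbers $p_{n,k}$ are the preferential attachment probabilities of the first node: $p_{n,k}$ is the probability that its degree equals $k$ at time $n$, where the degree is $1$ at time $1$ and, at each time $n\ge 2$, given that the degree at time $n-1$ is $d$, it increases by $1$ with probability $\frac{d}{2n-1}$ and stays unchanged otherwise. The claim depends only on the recursion stated in it. *)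

theory Defs imports Complex_Main begin

end

theory Submission imports Defs begin

text \<open>
  Stripping the common factor off \<open>p n k\<close> leaves the bracket, which depends on \<open>m = n - k\<close> and \<open>k\<close>
  only. It is the sum of the coefficients up to \<open>x ^ m\<close> of \<open>C(x/4) ^ (k - 1)\<close>, where \<open>C\<close> is the
  generating function of the Catalan numbers; its summands are scaled ballot numbers. In terms of
  the bracket \<open>B m k\<close>, the recursion for \<open>p\<close> becomes
  \<open>2(m + k - 1) B(m, k) = 2(k - 1) B(m, k - 1) + (2m + k - 1) B(m - 1, k)\<close>.
  The partial sums have no closed form, but the combination \<open>2 B(m, k) - B(m, k + 1)\<close> has one: it
  is the binomial coefficient \<open>(2m + k choose m) / 4 ^ m\<close> (lemma \<open>bracket_telescope\<close>).
  This holds at \<open>m = 0\<close>, and both sides have the same increments in \<open>m\<close>. Since \<open>2m + k\<close> times the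
  last summand of \<open>B(m, k + 1)\<close> is \<open>k\<close> times that same binomial coefficient, the transformed
  recursion follows for \<open>m \<ge> 1\<close>. On the diagonal \<open>m = 0\<close> it only says \<open>B(0, k) = B(0, k - 1)\<close>, because
  \<open>p (n - 1) n = 0\<close>, so an induction on \<open>n\<close> identifies \<open>p\<close>.
\<close>

definition ballot_term :: "nat \<Rightarrow> nat \<Rightarrow> real" where
  "ballot_term j k = fact (k + 2 * j) / (4 ^ Suc j * fact (Suc j) * fact (k + j))"

text \<open>The length \<open>m\<close> of the sum is an argument of its own, so that the diagonal \<open>k = n\<close>, where
  the sum is empty, is covered.\<close>

definition bracket :: "nat \<Rightarrow> nat \<Rightarrow> real" where
  "bracket m k = 1 + (real k - 1) * (\<Sum>j<m. ballot_term j k)"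

definition scaled_binomial :: "nat \<Rightarrow> nat \<Rightarrow> real" where
  "scaled_binomial m k = fact (2 * m + k) / (4 ^ m * fact m * fact (m + k))"

lemma bracket_0 [simp]: "bracket 0 k = 1"
  by (simp add: bracket_def)

lemma bracket_Suc: "bracket (Suc m) k = bracket m k + (real k - 1) * ballot_term m k"
  by (simp add: bracket_def algebra_simps)

text \<open>After division by the common factor \<open>u\<close> of all four terms, both sides equal
  \<open>k\<^sup>2 - k - 2m - 2\<close>.\<close>

lemma scaled_binomial_difference:
  "scaled_binomial (Suc m) k - scaled_binomial m k
    = 2 * (real k - 1) * ballot_term m k - real k * ballot_term m (Suc k)"
proof -
  define u :: real where
    "u = fact (k + 2 * m) / (4 ^ Suc m * fact (Suc m) * fact (Suc (k + m)))"
  have binom_Suc: "scaled_binomial (Suc m) k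
      = u * ((real k + 2 * real m + 2) * (real k + 2 * real m + 1))"
    by (simp add: scaled_binomial_def u_def add.commute algebra_simps)
  have binom: "scaled_binomial m k = u * (4 * (real m + 1) * (real k + real m + 1))"
    unfolding scaled_binomial_def u_def by (simp add: add.commute divide_simps)
  have ballot: "ballot_term m k = u * (real k + real m + 1)"
    unfolding ballot_term_def u_def by (simp add: divide_simps)
  have ballot_Suc: "ballot_term m (Suc k) = u * (real k + 2 * real m + 1)"
    unfolding ballot_term_def u_def by (simp add: divide_simps)
  show ?thesis
    unfolding binom_Suc binom ballot ballot_Suc by (simp add: algebra_simps)
qed

lemma bracket_telescope: "2 * bracket m k - bracket m (Suc k) = scaled_binomial m k"
proof (induction m)
  case 0
  show ?case by (simp add: scaled_binomial_def)
next
  case (Suc m)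
  then show ?case
    using scaled_binomial_difference [of m k] by (simp add: bracket_Suc algebra_simps)
qed

text \<open>Writing \<open>B(m + 1, k + 1)\<close> as \<open>B(m, k + 1)\<close> plus its last summand, one is left with
  the telescoped identity times \<open>k\<close>.\<close>

lemma bracket_recursion:
  "2 * (real m + 1 + real k) * bracket (Suc m) (Suc k)
    = 2 * real k * bracket (Suc m) k + (2 * real m + 2 + real k) * bracket m (Suc k)"
proof -
  have last: "(2 * real m + 2 + real k) * ballot_term m (Suc k) = scaled_binomial (Suc m) k"
    unfolding ballot_term_def scaled_binomial_def by (simp add: divide_simps add.commute)
  define x where "x = bracket m (Suc k)"
  define y where "y = ballot_term m (Suc k)"
  have split_last: "bracket (Suc m) (Suc k) = x + real k * y"
    by (simp add: bracket_Suc x_def y_def)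
  have "2 * bracket (Suc m) k = x + real k * y + (2 * real m + 2 + real k) * y"
    using bracket_telescope [of "Suc m" k] last split_last by (simp add: y_def)
  then have "2 * real k * bracket (Suc m) k
      = real k * (x + real k * y + (2 * real m + 2 + real k) * y)"
    by (simp add: mult.assoc mult.left_commute)
  then show ?thesis
    unfolding split_last x_def [symmetric] by (simp add: algebra_simps)
qed

definition prefactor :: "nat \<Rightarrow> real" where
  "prefactor n = fact n * fact (n - 1) / fact (2 * n) * 4 ^ n"

lemma prefactor_Suc:
  assumes "n \<ge> 1"
  shows "prefactor (Suc n) = prefactor n * (2 * real n / (2 * real n + 1))"
proof -
  obtain m where "n = Suc m"
    using assms by (cases n) auto
  then show ?thesis
    by (simp add: prefactor_def divide_simps) (simp add: algebra_simps)
qed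

lemma attachment_eq_bracket:
  fixes p :: "nat \<Rightarrow> nat \<Rightarrow> real"
  assumes init: "p 1 1 = 1"
    and zero: "\<And>n k. n \<ge> 1 \<Longrightarrow> k > n \<Longrightarrow> p n k = 0"
    and step: "\<And>n k. n \<ge> 2 \<Longrightarrow> 1 \<le> k \<Longrightarrow> k \<le> n \<Longrightarrow>
      p n k = (real k - 1) / (2 * real n - 1) * p (n - 1) (k - 1)
            + (2 * real n - 1 - real k) / (2 * real n - 1) * p (n - 1) k"
    and "n \<ge> 1" "1 \<le> k" "k \<le> n"
  shows "p n k = prefactor n / 2 ^ k * bracket (n - k) k"
  using \<open>n \<ge> 1\<close> \<open>1 \<le> k\<close> \<open>k \<le> n\<close>
proof (induction n arbitrary: k rule: nat_induct_at_least)
  case base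
  then have "k = 1" by simp
  then show ?case using init by (simp add: prefactor_def)
next
  case (Suc n)
  obtain i where k: "k = Suc i"
    using Suc.prems by (cases k) auto
  have "i \<le> n" using Suc.prems k by simp
  have rec: "p (Suc n) k = (real i * p n i + (2 * real n - real i) * p n k) / (2 * real n + 1)"
    using step [of "Suc n" k] Suc.hyps Suc.prems k by (simp add: add_divide_distrib add.commute)
  \<comment> \<open>For \<open>i = 0\<close> the induction hypothesis says nothing about \<open>p n i\<close>, but its coefficient vanishes.\<close>
  have left: "real i * p n i = real i * (prefactor n / 2 ^ i * bracket (n - i) i)"
    using Suc.IH [of i] \<open>i \<le> n\<close> by (cases "i = 0") auto
  have key: "real i * p n i + (2 * real n - real i) * p n k
      = prefactor n / 2 ^ k * (2 * real n * bracket (n - i) k)"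
  proof (cases "i = n")
    case True
    then have "p n k = 0" using zero Suc.hyps k by simp
    then show ?thesis using left True k by simp
  next
    case False
    define m where "m = n - k"
    have n: "n = m + 1 + i" using False \<open>i \<le> n\<close> k by (simp add: m_def)
    then have right: "p n k = prefactor n / 2 ^ k * bracket m k"
      using Suc.IH [of k] k by simp
    have "real i * p n i + (2 * real n - real i) * p n k
        = prefactor n / 2 ^ k *
          (2 * real i * bracket (Suc m) i + (2 * real m + 2 + real i) * bracket m k)"
      unfolding left right using n k by (simp add: field_simps)
    moreover have "2 * real n * bracket (n - i) k
        = 2 * real i * bracket (Suc m) i + (2 * real m + 2 + real i) * bracket m k"
      using bracket_recursion [of m i] n k by (simp add: add_ac)
    ultimately show ?thesis by simp
  qed
  show ?case
    unfolding rec key prefactor_Suc [OF Suc.hyps] using k by (simp add: mult_ac)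
qed

theorem mainTheorem2:
  fixes p :: "nat \<Rightarrow> nat \<Rightarrow> real" and n k :: nat
  assumes init: "p 1 1 = 1"
    and zero: "\<And>n k. n \<ge> 1 \<Longrightarrow> k > n \<Longrightarrow> p n k = 0"
    and step: "\<And>n k. n \<ge> 2 \<Longrightarrow> 1 \<le> k \<Longrightarrow> k \<le> n \<Longrightarrow>
      p n k = (real k - 1) / (2 * real n - 1) * p (n - 1) (k - 1)
            + (2 * real n - 1 - real k) / (2 * real n - 1) * p (n - 1) k"
    and "n > 1" and "1 \<le> k" and "k \<le> n - 1"
  shows "p n k = fact n * fact (n - 1) / fact (2 * n) * 2 ^ (2 * n - k) *
    (1 + (real k - 1) * (\<Sum>j = 0..n - k - 1.
       2 powi (- 2 * (int j + 1)) / fact (j + 1) * (fact (k + 2 * j) / fact (k + j))))"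
proof -
  have powi: "(2::real) powi (- 2 * (int j + 1)) = 1 / 4 ^ Suc j" for j
  proof -
    have "- 2 * (int j + 1) = - int (2 * Suc j)" by simp
    then have "(2::real) powi (- 2 * (int j + 1)) = inverse (2 powi int (2 * Suc j))"
      by (simp only: power_int_minus)
    also have "\<dots> = inverse ((2 ^ 2) ^ Suc j)"
      by (simp only: power_int_of_nat power_mult)
    finally show ?thesis by (simp add: field_simps)
  qed
  have "{0..n - k - 1} = {..<n - k}"
    using assms(4-6) by auto
  then have sum: "1 + (real k - 1) * (\<Sum>j = 0..n - k - 1.
       2 powi (- 2 * (int j + 1)) / fact (j + 1) * (fact (k + 2 * j) / fact (k + j)))
     = bracket (n - k) k"
    unfolding powi bracket_def ballot_term_def by simp
  have "(4::real) ^ n = 2 ^ k * 2 ^ (2 * n - k)"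
    using assms(6) by (simp add: power_add [symmetric] power_mult)
  then have "prefactor n / 2 ^ k = fact n * fact (n - 1) / fact (2 * n) * 2 ^ (2 * n - k)"
    by (simp add: prefactor_def)
  moreover have "p n k = prefactor n / 2 ^ k * bracket (n - k) k"
    using assms(4-6) by (intro attachment_eq_bracket [OF init zero step]) auto
  ultimately show ?thesis
    unfolding sum by simp
qed

end
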